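(* Let $T$ be a triangle with vertices $y_1,y_2,y_3$, let $r\in(1,3/2)$, and let $M\in\partial(\mathscr{T}_r)\setminus\{t_1(r),t_2(r),t_3(r)\}$. Let $\gamma_n(r,M)$ be the domination number of the $r$-factor proportional-edge proximity catch digraph with $M$-vertex regions on $n$ iid points uniformly distributed on $T$. Then $P(\gamma_n(r,M)=3)\to1$ as $n\to\infty$.
   Context: Let $y_1,y_2,y_3\in\mathbb{R}^2$ be non-collinear, $T$ the closed triangle with these vertices, $e_j$ the edge opposite $y_j$, and $b_j(x)$ the barycentric coordinate of $x\in T$ with respect to $y_j$. For $r\in[1,3/2]$ define $\mathscr{T}_r:=\{x\in T: b_j(x)\ge 1-1/r \text{ for } j=1,2,3\}$, the triangle bounded by the lines $q_j$ parallel to $e_j$ with $d(y_j,e_j)=r\,d(y_j,q_j)$; its vertices are $t_1(r),t_2(r),t_3(r)$, where $t_j(r)$ has barycentric coordinates $b_j=2/r-1$ and $b_k=1-1/r$ for $k\neq j$. For $M$ in the interior of $T$ and $k=1,2,3$, let $M_k$ be the point where the line through $y_k$ and $M$ meets $e_k$; the $M$-vertex region $R_M(y_j)$ is the closed quadrilateral with vertices $y_j,M_k,M,M_l$, $\{j,k,l\}=\{1,2,3\}$. For $x\in T\setminus\{y_1,y_2,y_3\}$ let $v(x)=y_j$ where $x\in R_M(y_j)$ (arbitrary choice on common boundaries). For such $x$ with $v(x)=y_j$, $N^r_{PE}(x,M)=\{z\in T: 1-b_j(z)\le r(1-b_j(x))\}$ (the intersection with $T$ of the triangle similar to $T$ with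 vertex $y_j$ whose opposite side is parallel to $e_j$ at $r$ times the distance from $y_j$ to the line through $x$ parallel to $e_j$); $N^r_{PE}(y_j,M)=\{y_j\}$. The digraph on $\{X_1,\dots,X_n\}$ has an arc $X_i\to X_j$ ($i\ne j$) iff $X_j\in N^r_{PE}(X_i,M)$; the domination number is the minimum cardinality of a vertex set $S$ such that every vertex is in $S$ or is the head of an arc from $S$. *)

theory Defs
  imports "HOL-Probability.Probability" "Graph_Theory.Digraph"
begin

text \<open>The vertices of the triangle are a family \<open>y :: 3 \<Rightarrow> real^2\<close> over the three-element
  type \<open>3\<close>; the definitions below are meant for \<open>\<not> collinear (range y)\<close>, which also makes
  the family injective.\<close>

definition closed_triangle :: "(3 \<Rightarrow> real^2) \<Rightarrow> (real^2) set" where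
  "closed_triangle y = convex hull (range y)"

definition opposite_edge :: "(3 \<Rightarrow> real^2) \<Rightarrow> 3 \<Rightarrow> (real^2) set" where
  "opposite_edge y j = convex hull (y ` (UNIV - {j}))"

definition bary :: "(3 \<Rightarrow> real^2) \<Rightarrow> real^2 \<Rightarrow> 3 \<Rightarrow> real" where
  "bary y x = (THE b. (\<Sum>j\<in>UNIV. b j) = 1 \<and> (\<Sum>j\<in>UNIV. b j *\<^sub>R y j) = x)"

definition inner_triangle :: "(3 \<Rightarrow> real^2) \<Rightarrow> real \<Rightarrow> (real^2) set" where
  "inner_triangle y r = {x \<in> closed_triangle y. \<forall>j. bary y x j \<ge> 1 - 1 / r}"

definition inner_vertex :: "(3 \<Rightarrow> real^2) \<Rightarrow> real \<Rightarrow> 3 \<Rightarrow> real^2" where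
  "inner_vertex y r j = (2 / r - 1) *\<^sub>R y j + (\<Sum>k\<in>UNIV - {j}. (1 - 1 / r) *\<^sub>R y k)"

text \<open>The intersection point below is unique for \<open>M\<close> in the interior of the triangle.\<close>

definition edge_point :: "(3 \<Rightarrow> real^2) \<Rightarrow> real^2 \<Rightarrow> 3 \<Rightarrow> real^2" where
  "edge_point y M k = (THE z. z \<in> affine hull {y k, M} \<and> z \<in> opposite_edge y k)"

text \<open>For \<open>M\<close> in the interior of the triangle the quadrilateral with vertices
  \<open>y j, edge_point y M k, M, edge_point y M l\<close> (where \<open>{j, k, l} = UNIV\<close>) is convex, so it is
  the convex hull of its vertices.\<close>

definition vertex_region :: "(3 \<Rightarrow> real^2) \<Rightarrow> real^2 \<Rightarrow> 3 \<Rightarrow> (real^2) set" where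
  "vertex_region y M j = convex hull ({y j, M} \<union> edge_point y M ` (UNIV - {j}))"

text \<open>The map \<open>v\<close> assigns to each point the index of a vertex region containing it; on common
  boundaries of vertex regions the choice is arbitrary. As \<open>v\<close> need not be measurable there,
  probabilities of events involving \<open>v\<close> have to be taken in the completion of the underlying
  probability space, which agrees with the original measure on its measurable sets.\<close>

definition region_choice :: "(3 \<Rightarrow> real^2) \<Rightarrow> real^2 \<Rightarrow> (real^2 \<Rightarrow> 3) \<Rightarrow> bool" where
  "region_choice y M v \<longleftrightarrow> (\<forall>x \<in> closed_triangle y - range y. x \<in> vertex_region y M (v x))"

text \<open>The dependence on \<open>M\<close> is only through \<open>v\<close>.\<close>

definition N_PE :: "(3 \<Rightarrow> real^2) \<Rightarrow> real \<Rightarrow> (real^2 \<Rightarrow> 3) \<Rightarrow> real^2 \<Rightarrow> (real^2) set" where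
  "N_PE y r v x =
    (if x \<in> range y then {x}
     else {z \<in> closed_triangle y. 1 - bary y z (v x) \<le> r * (1 - bary y x (v x))})"

definition catch_digraph :: "('a \<Rightarrow> 'a set) \<Rightarrow> 'a set \<Rightarrow> ('a, 'a \<times> 'a) pre_digraph" where
  "catch_digraph N V =
    \<lparr> verts = V, arcs = {(x, z). x \<in> V \<and> z \<in> V \<and> x \<noteq> z \<and> z \<in> N x}, tail = fst, head = snd \<rparr>"

definition dominating_set :: "('a, 'b) pre_digraph \<Rightarrow> 'a set \<Rightarrow> bool" where
  "dominating_set G S \<longleftrightarrow>
    S \<subseteq> verts G \<and> (\<forall>z \<in> verts G. z \<in> S \<or> (\<exists>x \<in> S. x \<rightarrow>\<^bsub>G\<^esub> z))"

definition domination_number :: "('a, 'b) pre_digraph \<Rightarrow> nat" where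
  "domination_number G = (LEAST k. \<exists>S. finite S \<and> dominating_set G S \<and> card S = k)"

end

(*
  Let c = 1 - 1/r. One barycentric coordinate of M, say the h-th, equals c and the other two exceed c.
  A point x in the region of y_k has b_k(x) >= b_k(M), so its proximity region misses the strip
  b_k < r (b_k(M) - c) along e_k: a fixed strip for k ~= h, and an empty one for k = h. But x can have
  b_h(x) < b_h(M) + d only inside a box of area O(d^2) around M. With d = n^(-2/3) this
  box contains no sample point with high probability, and then the strip b_h < r d is missed by
  class h, too. Each intersection of two of the three strips has area at least of order d, so with
  high probability it contains a sample point; hence no two points dominate. Three points always do:
  in each region take the one farthest from its vertex.
*)
theory Submission
  imports Defs "HOL-Real_Asymp.Real_Asymp"
begin

subsection \<open>Barycentric coordinates\<close>

lemma UNIV_distinct: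
  fixes j k l :: 3
  assumes "j \<noteq> k" "k \<noteq> l" "j \<noteq> l"
  shows "UNIV = {j, k, l}"
  using assms exhaust_3[of j] exhaust_3[of k] exhaust_3[of l] UNIV_3 by auto

lemma sum_distinct:
  fixes j k l :: 3 and f :: "3 \<Rightarrow> 'b::comm_monoid_add"
  assumes "j \<noteq> k" "k \<noteq> l" "j \<noteq> l"
  shows "(\<Sum>i\<in>UNIV. f i) = f j + f k + f l"
  using assms by (simp add: UNIV_distinct[OF assms] add.assoc)

lemma third_index:
  fixes k l :: 3
  obtains j where "j \<noteq> k" "j \<noteq> l"
proof -
  have "card {k, l} \<le> 2"
    by (simp add: card_insert_if)
  then have "{k, l} \<noteq> UNIV"
    by (auto dest!: arg_cong[of _ _ card])
  then show ?thesis using that by blast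
qed

locale triangle =
  fixes y :: "3 \<Rightarrow> real^2"
  assumes noncollinear: "\<not> collinear (range y)"
begin

text \<open>A linear self-map of the plane that sends the unit vectors to the two edge vectors at
  \<open>y j\<close>. In this form injectivity gives surjectivity, and the determinant formula for
  areas applies.\<close>

definition frame :: "3 \<Rightarrow> 3 \<Rightarrow> 3 \<Rightarrow> real^2 \<Rightarrow> real^2" where
  "frame j k l w = (w $ 1) *\<^sub>R (y k - y j) + (w $ 2) *\<^sub>R (y l - y j)"

lemma linear_frame: "linear (frame j k l)"
  unfolding frame_def by (intro linearI) (auto simp: algebra_simps)

lemma inj_frame:
  assumes "j \<noteq> k" "k \<noteq> l" "j \<noteq> l"
  shows "inj (frame j k l)"
proof -
  have "range y = y ` {j, k, l}"
    by (simp only: UNIV_distinct[OF assms])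
  then have "\<not> collinear {y k, y j, y l}"
    using noncollinear by (simp add: insert_commute)
  then have nc: "\<not> collinear {0, y k - y j, y l - y j}"
    by (subst (asm) collinear_3) auto
  have "w = 0" if "frame j k l w = 0" for w
  proof -
    have e: "(w $ 1) *\<^sub>R (y k - y j) + (w $ 2) *\<^sub>R (y l - y j) = 0"
      using that by (simp add: frame_def)
    have w2: "w $ 2 = 0"
    proof (rule ccontr)
      assume n: "w $ 2 \<noteq> 0"
      have "y l - y j = inverse (w $ 2) *\<^sub>R ((w $ 2) *\<^sub>R (y l - y j))"
        using n by simp
      also have "(w $ 2) *\<^sub>R (y l - y j) = - ((w $ 1) *\<^sub>R (y k - y j))"
        using e by (simp add: add_eq_0_iff)
      finally have "y l - y j = (- inverse (w $ 2) * (w $ 1)) *\<^sub>R (y k - y j)"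
        by simp
      then show False
        using nc collinear_lemma by blast
    qed
    then have "w $ 1 = 0"
      using e nc by (auto simp: collinear_lemma)
    with w2 show ?thesis
      by (simp add: vec_eq_iff forall_2)
  qed
  then show ?thesis
    using linear_injective_0[OF linear_frame] by blast
qed

lemma surj_frame:
  assumes "j \<noteq> k" "k \<noteq> l" "j \<noteq> l"
  shows "surj (frame j k l)"
  using linear_injective_imp_surjective[OF linear_frame inj_frame[OF assms]] by simp

text \<open>Eliminating \<open>b j\<close> turns weights into \<open>frame\<close> coordinates, so
  uniqueness of barycentric coordinates reduces to injectivity of \<open>frame\<close>.\<close>

lemma barycentric_frame:
  assumes "j \<noteq> k" "k \<noteq> l" "j \<noteq> l" "(\<Sum>i\<in>UNIV. b i) = 1"
  shows "(\<Sum>i\<in>UNIV. b i *\<^sub>R y i) = y j + frame j k l (vector [b k, b l])"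
proof -
  have b: "b j = 1 - b k - b l"
    using assms(4) by (simp add: sum_distinct[OF assms(1-3)])
  show ?thesis
    by (simp add: sum_distinct[OF assms(1-3)] b frame_def scaleR_diff_left scaleR_diff_right)
qed

lemma barycentric_unique:
  assumes "(\<Sum>i\<in>UNIV. a i) = (1::real)" "(\<Sum>i\<in>UNIV. b i) = 1"
    "(\<Sum>i\<in>UNIV. a i *\<^sub>R y i) = (\<Sum>i\<in>UNIV. b i *\<^sub>R y i)"
  shows "a = b"
proof
  fix k :: 3
  obtain j where j: "j \<noteq> k" using third_index .
  obtain l where l: "l \<noteq> k" "l \<noteq> j" using third_index .
  have d: "j \<noteq> k" "k \<noteq> l" "j \<noteq> l" using j l by auto
  have "frame j k l (vector [a k, a l]) = frame j k l (vector [b k, b l])"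
    using assms(3) barycentric_frame[OF d assms(1)] barycentric_frame[OF d assms(2)] by simp
  then have "(vector [a k, a l] :: real^2) = vector [b k, b l]"
    using inj_frame[OF d] by (simp add: inj_eq)
  then show "a k = b k"
    by (metis vector_2(1))
qed

lemma barycentric_exists: "\<exists>b. (\<Sum>i\<in>UNIV. b i) = 1 \<and> (\<Sum>i\<in>UNIV. b i *\<^sub>R y i) = x"
proof -
  have d: "(1::3) \<noteq> 2" "(2::3) \<noteq> 3" "(1::3) \<noteq> 3" by auto
  obtain w where w: "x - y 1 = frame 1 2 3 w"
    using surj_frame[OF d] by (metis surjD)
  let ?b = "\<lambda>i::3. if i = 1 then 1 - w $ 1 - w $ 2 else if i = 2 then w $ 1 else w $ 2"
  have 1: "(\<Sum>i\<in>UNIV. ?b i) = 1"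
    by (simp add: sum_3)
  moreover have "(\<Sum>i\<in>UNIV. ?b i *\<^sub>R y i) = x"
    using w by (simp add: sum_3 frame_def algebra_simps)
  ultimately show ?thesis by blast
qed

lemma bary_spec:
  shows sum_bary: "(\<Sum>i\<in>UNIV. bary y x i) = 1"
    and sum_bary_scaleR: "(\<Sum>i\<in>UNIV. bary y x i *\<^sub>R y i) = x"
proof -
  have "\<exists>!b. (\<Sum>i\<in>UNIV. b i) = 1 \<and> (\<Sum>i\<in>UNIV. b i *\<^sub>R y i) = x"
    using barycentric_exists barycentric_unique by (intro ex_ex1I) auto
  from theI'[OF this] show "(\<Sum>i\<in>UNIV. bary y x i) = 1" "(\<Sum>i\<in>UNIV. bary y x i *\<^sub>R y i) = x"
    by (simp_all add: bary_def)
qed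

lemma bary_eqI:
  assumes "(\<Sum>i\<in>UNIV. b i) = 1" "(\<Sum>i\<in>UNIV. b i *\<^sub>R y i) = x"
  shows "bary y x = b"
  by (rule barycentric_unique) (simp_all add: assms sum_bary sum_bary_scaleR)

lemma bary_affine:
  assumes "s + t = 1"
  shows "bary y (s *\<^sub>R x + t *\<^sub>R z) i = s * bary y x i + t * bary y z i"
proof -
  have "bary y (s *\<^sub>R x + t *\<^sub>R z) = (\<lambda>i. s * bary y x i + t * bary y z i)"
  proof (rule bary_eqI)
    show "(\<Sum>i\<in>UNIV. s * bary y x i + t * bary y z i) = 1"
      using assms by (simp add: sum.distrib flip: sum_distrib_left) (simp add: sum_bary)
    show "(\<Sum>i\<in>UNIV. (s * bary y x i + t * bary y z i) *\<^sub>R y i) = s *\<^sub>R x + t *\<^sub>R z"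
      by (simp add: sum.distrib scaleR_add_left flip: scaleR_scaleR scaleR_right.sum)
         (simp add: sum_bary_scaleR)
  qed
  then show ?thesis by simp
qed

lemma bary_vertex: "bary y (y j) i = (if i = j then 1 else 0)"
proof -
  have "bary y (y j) = (\<lambda>i. if i = j then 1 else 0)"
    by (rule bary_eqI) (simp_all add: if_distrib[of "\<lambda>c. c *\<^sub>R _"] cong: if_cong)
  then show ?thesis by simp
qed

text \<open>Measured from its value at 0, an affine function is linear, hence an inner product with
  a fixed vector. This yields continuity of the coordinates and, later, null lines.\<close>

lemma bary_inner:
  obtains a where "\<And>x. bary y x i = bary y 0 i + a \<bullet> x"
proof -
  let ?f = "\<lambda>x. bary y x i - bary y 0 i"
  have scale: "?f (c *\<^sub>R x) = c * ?f x" for c x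
    using bary_affine[of c "1 - c" x 0 i] by (simp add: algebra_simps)
  \<comment> \<open>\<open>x + z\<close> is twice the midpoint of \<open>x\<close> and
    \<open>z\<close>, so additivity follows from homogeneity and affinity.\<close>
  have add: "?f (x + z) = ?f x + ?f z" for x z
    using scale[of 2 "(1/2) *\<^sub>R x + (1/2) *\<^sub>R z"] bary_affine[of "1/2" "1/2" x z i]
    by (simp add: algebra_simps)
  have "linear ?f"
    by (rule linearI) (simp_all only: add scale real_scaleR_def)
  from adjoint_works[OF this, of _ 1]
  have "bary y x i = bary y 0 i + adjoint ?f 1 \<bullet> x" for x
    by (simp add: inner_commute)
  then show ?thesis using that by blast
qed

lemma continuous_on_bary [continuous_intros]: "continuous_on A (\<lambda>x. bary y x i)"
proof -
  obtain a where a: "\<And>x. bary y x i = bary y 0 i + a \<bullet> x" using bary_inner[of i] by blast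
  have "continuous_on A (\<lambda>x. bary y 0 i + a \<bullet> x)"
    by (intro continuous_intros)
  then show ?thesis unfolding a[symmetric] .
qed

lemma borel_measurable_bary [measurable]: "(\<lambda>x. bary y x i) \<in> borel_measurable borel"
  by (intro borel_measurable_continuous_onI continuous_intros)

lemma closed_triangle_iff: "x \<in> closed_triangle y \<longleftrightarrow> (\<forall>i. bary y x i \<ge> 0)"
proof
  have "convex {x. \<forall>i. bary y x i \<ge> 0}"
    by (rule convexI) (auto simp: bary_affine)
  moreover have "range y \<subseteq> {x. \<forall>i. bary y x i \<ge> 0}"
    by (auto simp: bary_vertex)
  ultimately have "closed_triangle y \<subseteq> {x. \<forall>i. bary y x i \<ge> 0}"
    unfolding closed_triangle_def by (rule hull_minimal[rotated])
  then show "x \<in> closed_triangle y \<Longrightarrow> \<forall>i. bary y x i \<ge> 0" by blast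
next
  assume "\<forall>i. bary y x i \<ge> 0"
  then have "(\<Sum>i\<in>UNIV. bary y x i *\<^sub>R y i) \<in> closed_triangle y"
    unfolding closed_triangle_def
    by (intro convex_sum) (auto simp: sum_bary hull_inc)
  then show "x \<in> closed_triangle y" by (simp add: sum_bary_scaleR)
qed

section \<open>Edges, edge points and vertex regions in barycentric coordinates\<close>

lemma opposite_edgeI:
  assumes "\<And>i. bary y x i \<ge> 0" "bary y x k = 0"
  shows "x \<in> opposite_edge y k"
proof -
  have "(\<Sum>i\<in>UNIV - {k}. bary y x i) = 1" "(\<Sum>i\<in>UNIV - {k}. bary y x i *\<^sub>R y i) = x"
    using sum_bary[of x] sum_bary_scaleR[of x] assms(2)
    by (simp_all add: sum.remove[of UNIV k])
  moreover have "(\<Sum>i\<in>UNIV - {k}. bary y x i *\<^sub>R y i) \<in> opposite_edge y k"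
    unfolding opposite_edge_def
    by (intro convex_sum) (auto simp: assms calculation hull_inc)
  ultimately show ?thesis by simp
qed

lemma bary_opposite_edge:
  assumes "x \<in> opposite_edge y k"
  shows "bary y x k = 0"
proof -
  have "convex {x. bary y x k = 0}"
    by (rule convexI) (auto simp: bary_affine)
  moreover have "y ` (UNIV - {k}) \<subseteq> {x. bary y x k = 0}"
    by (auto simp: bary_vertex)
  ultimately have "opposite_edge y k \<subseteq> {x. bary y x k = 0}"
    unfolding opposite_edge_def by (rule hull_minimal[rotated])
  then show ?thesis using assms by blast
qed

lemma bary_less_one:
  assumes "\<And>i. bary y M i > 0"
  shows "bary y M k < 1"
proof -
  obtain j where j: "j \<noteq> k" using third_index .
  obtain l where l: "l \<noteq> k" "l \<noteq> j" using third_index .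
  have "bary y M j + bary y M k + bary y M l = 1"
    using sum_bary[of M] sum_distinct[of j k l] j l by metis
  then show ?thesis using assms[of j] assms[of l] by linarith
qed

text \<open>Along the line through \<open>y k\<close> and \<open>M\<close> the coordinate
  \<open>k\<close> is affine, with value 1 at \<open>y k\<close> and \<open>bary y M k < 1\<close>
  at \<open>M\<close>. Its unique zero fixes the weight of \<open>M\<close>.\<close>

lemma edge_point_eq:
  assumes "\<And>i. bary y M i > 0"
  shows "edge_point y M k = (1 / (1 - bary y M k)) *\<^sub>R M + (- bary y M k / (1 - bary y M k)) *\<^sub>R y k"
    (is "_ = ?z")
proof -
  note lt = bary_less_one[OF assms, of k]
  have one: "1 / (1 - bary y M k) + - bary y M k / (1 - bary y M k) = 1"
    using lt by (simp add: field_simps)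
  have b: "bary y ?z i = (bary y M i - bary y M k * (if i = k then 1 else 0)) / (1 - bary y M k)" for i
    unfolding bary_affine[OF one] by (simp add: bary_vertex diff_divide_distrib)
  show ?thesis
    unfolding edge_point_def
  proof (rule the_equality)
    have "?z \<in> affine hull {y k, M}"
      unfolding affine_hull_2 using one by (smt (verit, best) add.commute mem_Collect_eq)
    moreover have "?z \<in> opposite_edge y k"
      by (rule opposite_edgeI; unfold b) (use lt assms in \<open>auto simp: less_imp_le\<close>)
    ultimately show "?z \<in> affine hull {y k, M} \<and> ?z \<in> opposite_edge y k" by blast
  next
    fix z
    assume z: "z \<in> affine hull {y k, M} \<and> z \<in> opposite_edge y k"
    then obtain s t where st: "z = s *\<^sub>R y k + t *\<^sub>R M" "s + t = 1"
      unfolding affine_hull_2 by blast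
    have "s + t * bary y M k = 0"
      using bary_opposite_edge[of z k] z bary_affine[OF st(2), of "y k" M k] st(1)
      by (simp add: bary_vertex)
    moreover have "s = 1 - t" using st(2) by simp
    ultimately have "t * (1 - bary y M k) = 1" by (simp add: algebra_simps)
    then have t: "t = 1 / (1 - bary y M k)" using lt by (simp add: field_simps)
    moreover have "s = - bary y M k / (1 - bary y M k)"
      using st(2) one t by linarith
    ultimately show "z = ?z" using st(1) by (simp add: add.commute)
  qed
qed

text \<open>For \<open>k \<noteq> j\<close> the inequality describes a half-plane bounded by the
  line through \<open>M\<close> and the third vertex. Half-planes are convex, so it suffices to test
  the four points spanning the region.\<close>

lemma vertex_region_bary:
  assumes M: "\<And>i. bary y M i > 0" and x: "x \<in> vertex_region y M j"
  shows "bary y x k * bary y M j \<le> bary y x j * bary y M k"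
proof -
  let ?H = "{x. bary y x k * bary y M j \<le> bary y x j * bary y M k}"
  have "convex ?H"
  proof (rule convexI, clarify)
    fix x z :: "real^2" and s t :: real
    assume h: "bary y x k * bary y M j \<le> bary y x j * bary y M k"
      "bary y z k * bary y M j \<le> bary y z j * bary y M k" "0 \<le> s" "0 \<le> t" "s + t = 1"
    have "s * (bary y x k * bary y M j) + t * (bary y z k * bary y M j)
        \<le> s * (bary y x j * bary y M k) + t * (bary y z j * bary y M k)"
      using h by (intro add_mono mult_left_mono)
    then show "bary y (s *\<^sub>R x + t *\<^sub>R z) k * bary y M j \<le> bary y (s *\<^sub>R x + t *\<^sub>R z) j * bary y M k"
      using h by (simp add: bary_affine algebra_simps)
  qed
  moreover have "y j \<in> ?H" "M \<in> ?H"
    using M[of k] by (auto simp: bary_vertex less_imp_le)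
  moreover have "edge_point y M i \<in> ?H" if "i \<noteq> j" for i
  proof -
    note lt = bary_less_one[OF M, of i]
    have one: "1 / (1 - bary y M i) + - bary y M i / (1 - bary y M i) = 1"
      using lt by (simp add: field_simps)
    have b: "bary y (edge_point y M i) h = (bary y M h - bary y M i * (if h = i then 1 else 0)) / (1 - bary y M i)" for h
      unfolding edge_point_eq[OF M] bary_affine[OF one] by (simp add: bary_vertex diff_divide_distrib)
    \<comment> \<open>For \<open>i = k\<close> the edge point has coordinate \<open>k\<close> equal
      to zero; otherwise it lies on the bounding line and equality holds.\<close>
    show ?thesis
      using that lt M[of j] M[of k] by (auto simp: b field_simps)
  qed
  ultimately have "vertex_region y M j \<subseteq> ?H"
    unfolding vertex_region_def by (intro hull_minimal) auto
  then show ?thesis using x by blast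
qed

section \<open>The boundary of the inner triangle\<close>

text \<open>Closedness gives all the lower bounds at \<open>M\<close>. Were they all strict, they
  would persist in a neighbourhood and \<open>M\<close> would be interior.\<close>

lemma frontier_inner_triangle:
  assumes "1 < r" and M: "M \<in> frontier (inner_triangle y r)"
  shows "\<And>i. bary y M i \<ge> 1 - 1 / r" and "\<exists>i. bary y M i = 1 - 1 / r"
proof -
  have pos: "1 - 1 / r > 0" using assms(1) by simp
  have eq: "inner_triangle y r = {x. \<forall>i. bary y x i \<ge> 1 - 1 / r}"
    unfolding inner_triangle_def closed_triangle_iff using pos by (smt (verit) Collect_cong)
  have "closed (inner_triangle y r)"
    unfolding eq by (intro closed_Collect_all closed_Collect_le continuous_intros)
  then have "M \<in> inner_triangle y r"
    using M by (simp add: frontier_def)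
  then show ge: "bary y M i \<ge> 1 - 1 / r" for i by (simp add: eq)
  show "\<exists>i. bary y M i = 1 - 1 / r"
  proof (rule ccontr)
    assume "\<not> ?thesis"
    then have "M \<in> (\<Inter>i. {x. bary y x i > 1 - 1 / r})"
      using ge by (auto simp: less_le)
    moreover have "open (\<Inter>i. {x. bary y x i > 1 - 1 / r})"
      by (intro open_INT ballI open_Collect_less continuous_intros finite)
    moreover have "(\<Inter>i. {x. bary y x i > 1 - 1 / r}) \<subseteq> inner_triangle y r"
      by (auto simp: eq less_imp_le)
    ultimately have "M \<in> interior (inner_triangle y r)"
      by (auto intro: interiorI)
    then show False using M by (simp add: frontier_def)
  qed
qed

text \<open>Two coordinates equal to \<open>1 - 1 / r\<close> force the third to be
  \<open>2 / r - 1\<close>, which makes \<open>M\<close> an inner vertex. Hence \<open>M\<close>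
  lies on exactly one side.\<close>

lemma frontier_inner_triangle_nonvertex:
  assumes "1 < r" and M: "M \<in> frontier (inner_triangle y r) - range (inner_vertex y r)"
  obtains j where "bary y M j = 1 - 1 / r" "\<And>i. i \<noteq> j \<Longrightarrow> bary y M i > 1 - 1 / r"
proof -
  have ge: "bary y M i \<ge> 1 - 1 / r" for i
    using frontier_inner_triangle assms by blast
  obtain j where j: "bary y M j = 1 - 1 / r"
    using frontier_inner_triangle assms by blast
  have "bary y M i \<noteq> 1 - 1 / r" if "i \<noteq> j" for i
  proof
    assume i: "bary y M i = 1 - 1 / r"
    obtain h where h: "h \<noteq> i" "h \<noteq> j" using third_index .
    have d: "h \<noteq> i" "i \<noteq> j" "h \<noteq> j" using that h by auto
    have bh: "bary y M h = 2 / r - 1"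
      using sum_bary[of M] i j by (simp add: sum_distinct[OF d])
    have "UNIV - {h} = {i, j}" using d UNIV_distinct[OF d] by auto
    then have "inner_vertex y r h = (\<Sum>i\<in>UNIV. bary y M i *\<^sub>R y i)"
      using d by (simp add: inner_vertex_def sum_distinct[OF d] bh i j)
    then show False using M by (auto simp: sum_bary_scaleR)
  qed
  then show ?thesis using that j ge by (metis less_le)
qed

section \<open>Lebesgue measure in barycentric coordinates\<close>

lemma bary_frame:
  assumes "j \<noteq> k" "k \<noteq> l" "j \<noteq> l"
  shows "bary y (y j + frame j k l w) k = w $ 1" "bary y (y j + frame j k l w) l = w $ 2"
proof -
  let ?b = "\<lambda>i. if i = k then w $ 1 else if i = l then w $ 2 else 1 - w $ 1 - w $ 2"
  have s: "(\<Sum>i\<in>UNIV. ?b i) = 1"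
    using assms by (simp add: sum_distinct[OF assms])
  have "bary y (y j + frame j k l w) = ?b"
    using assms by (intro bary_eqI s) (simp add: sum_distinct[OF assms] frame_def algebra_simps)
  then show "bary y (y j + frame j k l w) k = w $ 1" "bary y (y j + frame j k l w) l = w $ 2"
    using assms by auto
qed

text \<open>The set is a translate of the image of a rectangle under \<open>frame j k l\<close>, so
  \<open>D\<close> is the absolute value of the determinant. All area estimates below come from this
  formula.\<close>

lemma measure_bary_box:
  assumes "k \<noteq> l"
  obtains D where "D > 0"
    "\<And>p q p' q'. p \<le> q \<Longrightarrow> p' \<le> q' \<Longrightarrow>
      emeasure lborel {x. bary y x k \<in> {p..q} \<and> bary y x l \<in> {p'..q'}} = ennreal (D * ((q - p) * (q' - p')))"
proof -
  obtain j where "j \<noteq> k" "j \<noteq> l" using third_index .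
  then have d: "j \<noteq> k" "k \<noteq> l" "j \<noteq> l" using assms by auto
  let ?D = "\<bar>det (matrix (frame j k l))\<bar>"
  have "?D > 0"
    using det_nz_iff_inj[OF linear_frame] inj_frame[OF d] by simp
  moreover have "emeasure lborel {x. bary y x k \<in> {p..q} \<and> bary y x l \<in> {p'..q'}} = ennreal (?D * ((q - p) * (q' - p')))"
    if le: "p \<le> q" "p' \<le> q'" for p q p' q'
  proof -
    let ?S = "{x. bary y x k \<in> {p..q} \<and> bary y x l \<in> {p'..q'}}"
    define B :: "(real^2) set" where "B = cbox (vector [p, p']) (vector [q, q'])"
    have B: "w \<in> B \<longleftrightarrow> w $ 1 \<in> {p..q} \<and> w $ 2 \<in> {p'..q'}" for w
      by (auto simp: B_def mem_box_cart forall_2)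
    have "vector [p, p'] \<in> B"
      using le by (simp add: B)
    then have "B \<noteq> {}" by auto
    then have mB: "measure lebesgue B = (q - p) * (q' - p')"
      by (simp add: B_def content_cbox_cart prod_2 UNIV_2)
    have S: "?S = (+) (y j) ` frame j k l ` B"
    proof (rule set_eqI)
      fix x
      obtain w where "x - y j = frame j k l w"
        using surj_frame[OF d] by (metis surjD)
      then have x: "x = y j + frame j k l w" by (simp add: algebra_simps)
      show "x \<in> ?S \<longleftrightarrow> x \<in> (+) (y j) ` frame j k l ` B"
        using inj_frame[OF d] by (auto simp: x bary_frame[OF d] B inj_eq image_iff)
    qed
    have lm: "B \<in> lmeasurable"
      by (simp add: B_def)
    have "frame j k l ` B \<in> lmeasurable"
      using measurable_linear_image[OF linear_frame lm] .
    moreover have "measure lebesgue ?S = ?D * ((q - p) * (q' - p'))"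
      unfolding S measure_translation measure_linear_image[OF linear_frame lm] mB ..
    ultimately have "emeasure lebesgue ?S = ennreal (?D * ((q - p) * (q' - p')))"
      by (metis S emeasure_eq_measure2 measurable_translation)
    moreover have "?S \<in> sets lborel"
      by measurable
    ultimately show ?thesis
      by (simp add: emeasure_completion)
  qed
  ultimately show ?thesis using that by blast
qed

lemma compact_closed_triangle: "compact (closed_triangle y)"
  unfolding closed_triangle_def by (intro finite_imp_compact_convex_hull) simp

lemma sets_closed_triangle [measurable]: "closed_triangle y \<in> sets borel"
  using compact_closed_triangle by (intro borel_closed compact_imp_closed)

text \<open>Nonzero because the parallelogram with two coordinates in \<open>{0..1/2}\<close> fits
  into the triangle; finite because the triangle is bounded. Both facts are what
  \<open>uniform_measure\<close> requires.\<close>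

lemma emeasure_closed_triangle:
  "emeasure lborel (closed_triangle y) \<noteq> 0" "emeasure lborel (closed_triangle y) \<noteq> \<infinity>"
proof -
  obtain D where D: "D > 0"
    "\<And>p q p' q'. p \<le> q \<Longrightarrow> p' \<le> q' \<Longrightarrow>
      emeasure lborel {x. bary y x 1 \<in> {p..q} \<and> bary y x 2 \<in> {p'..q'}} = ennreal (D * ((q - p) * (q' - p')))"
    using measure_bary_box[of 1 2] by auto
  let ?S = "{x. bary y x 1 \<in> {0..1/2} \<and> bary y x 2 \<in> {0..1/2}}"
  have "?S \<subseteq> closed_triangle y"
    using sum_bary by (auto simp: closed_triangle_iff forall_3 sum_3) (smt (verit) field_sum_of_halves)
  then have "emeasure lborel ?S \<le> emeasure lborel (closed_triangle y)"
    by (intro emeasure_mono) auto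
  moreover have "emeasure lborel ?S > 0"
    using D(1) by (subst D(2)) auto
  ultimately show "emeasure lborel (closed_triangle y) \<noteq> 0" by auto
  show "emeasure lborel (closed_triangle y) \<noteq> \<infinity>"
    using emeasure_bounded_finite[OF compact_imp_bounded[OF compact_closed_triangle]] by simp
qed

lemma measure_closed_triangle_pos: "measure lborel (closed_triangle y) > 0"
  using emeasure_closed_triangle
  by (simp add: measure_def enn2real_positive_iff top.not_eq_extremum zero_less_iff_neq_zero)

text \<open>Equality is one affine equation in \<open>x\<close>, and its solutions form a negligible
  set unless the equation degenerates to \<open>0 = 0\<close>.\<close>

lemma AE_bary_ratio:
  assumes "k \<noteq> l" "s \<noteq> 0"
  shows "AE x in lborel. bary y x k * s \<noteq> bary y x l * t"
proof -
  obtain a where a: "\<And>x. bary y x k = bary y 0 k + a \<bullet> x" using bary_inner[of k] by blast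
  obtain b where b: "\<And>x. bary y x l = bary y 0 l + b \<bullet> x" using bary_inner[of l] by blast
  let ?c = "s *\<^sub>R a - t *\<^sub>R b" and ?d = "t * bary y 0 l - s * bary y 0 k"
  have iff: "bary y x k * s = bary y x l * t \<longleftrightarrow> ?c \<bullet> x = ?d" for x
    using a[of x] b[of x] by (simp add: algebra_simps inner_diff_left)
  \<comment> \<open>At \<open>y k\<close> the left side is \<open>s\<close>, which is nonzero, and
    the right side is 0, so the equation is not an identity.\<close>
  have "?c \<noteq> 0 \<or> ?d \<noteq> 0"
    using iff[of "y k"] assms by (auto simp: bary_vertex)
  then have "negligible {x. ?c \<bullet> x = ?d}"
    by (rule negligible_hyperplane)
  then have "AE x in lebesgue. x \<notin> {x. ?c \<bullet> x = ?d}"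
    by (intro AE_not_in) (simp add: negligible_iff_null_sets)
  then show ?thesis
    by (simp add: AE_completion_iff iff)
qed

end

subsection \<open>Domination numbers of catch digraphs\<close>

lemma verts_catch_digraph [simp]: "verts (catch_digraph N V) = V"
  by (simp add: catch_digraph_def)

lemma dominating_set_catch_digraph:
  "dominating_set (catch_digraph N V) S \<longleftrightarrow>
    S \<subseteq> V \<and> (\<forall>z\<in>V. \<exists>x\<in>S. z = x \<or> z \<in> N x)"
  by (auto simp: dominating_set_def catch_digraph_def arcs_ends_def arc_to_ends_def image_iff)

text \<open>Replaces \<open>LEAST\<close> by two existence statements with upper bounds on the
  cardinality. The set of all vertices dominates, so the minimum is attained.\<close>

lemma domination_number_eq_Suc_iff:
  assumes "finite (verts G)"
  shows "domination_number G = Suc k \<longleftrightarrow>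
    (\<exists>S. finite S \<and> dominating_set G S \<and> card S \<le> Suc k) \<and>
    \<not> (\<exists>S. finite S \<and> dominating_set G S \<and> card S \<le> k)"
proof -
  let ?P = "\<lambda>k. \<exists>S. finite S \<and> dominating_set G S \<and> card S = k"
  have "?P (card (verts G))"
    using assms by (auto simp: dominating_set_def)
  then have P: "?P (domination_number G)"
    unfolding domination_number_def by (rule LeastI)
  have le: "domination_number G \<le> card S" if "finite S" "dominating_set G S" for S
    unfolding domination_number_def using that by (auto intro: Least_le)
  have "(\<exists>S. finite S \<and> dominating_set G S \<and> card S \<le> n) \<longleftrightarrow> domination_number G \<le> n" for n
    using P le by (metis le_trans order_refl)
  then show ?thesis by auto
qed

text \<open>Index sets \<open>J\<close> range over a fixed finite family while the vertex set varies
  with the sample, which suits measurability proofs. Sample points may coincide, so \<open>J\<close>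
  is chosen with \<open>X\<close> injective on it.\<close>

lemma dominating_set_image_iff:
  assumes "finite I"
  shows "(\<exists>S. finite S \<and> dominating_set (catch_digraph N (X ` I)) S \<and> card S \<le> k) \<longleftrightarrow>
    (\<exists>J\<in>{J\<in>Pow I. card J \<le> k}. \<forall>i\<in>I. \<exists>j\<in>J. X i = X j \<or> X i \<in> N (X j))"
    (is "?L \<longleftrightarrow> ?R")
proof
  assume ?L
  then obtain S where S: "S \<subseteq> X ` I" "\<forall>i\<in>I. \<exists>x\<in>S. X i = x \<or> X i \<in> N x" "card S \<le> k"
    by (auto simp: dominating_set_catch_digraph)
  then obtain J where "J \<subseteq> I" "inj_on X J" "S = X ` J"
    by (auto simp: subset_image_inj)
  with S show ?R by (auto simp: card_image intro!: exI[of _ J])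
next
  assume ?R
  then obtain J where J: "J \<subseteq> I" "card J \<le> k" "\<forall>i\<in>I. \<exists>j\<in>J. X i = X j \<or> X i \<in> N (X j)"
    by auto
  then have "finite J" using assms finite_subset by blast
  then have "card (X ` J) \<le> k" using J(2) card_image_le le_trans by blast
  then show ?L using J \<open>finite J\<close>
    by (intro exI[of _ "X ` J"]) (auto simp: dominating_set_catch_digraph)
qed

section \<open>Domination in the proximity digraph\<close>

lemma self_in_N_PE: "x \<in> closed_triangle y \<Longrightarrow> 1 \<le> r \<Longrightarrow> bary y x (v x) \<le> 1 \<Longrightarrow> x \<in> N_PE y r v x"
  by (auto simp: N_PE_def mult_le_cancel_right1)

context triangle
begin

lemma bary_le_one: "x \<in> closed_triangle y \<Longrightarrow> bary y x j \<le> 1"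
  using sum_bary[of x] member_le_sum[of j UNIV "bary y x"] by (auto simp: closed_triangle_iff)

text \<open>In every colour class of \<open>v\<close> a point farthest from its vertex dominates the whole class.\<close>

lemma dominating_set_card_le_3:
  assumes "finite V" "V \<subseteq> closed_triangle y - range y" "1 \<le> r"
  shows "\<exists>S. finite S \<and> dominating_set (catch_digraph (N_PE y r v) V) S \<and> card S \<le> 3"
proof -
  let ?C = "\<lambda>j. {x \<in> V. v x = j}"
  define f where "f j = arg_min_on (\<lambda>x. bary y x j) (?C j)" for j
  have f: "f j \<in> ?C j" "\<And>z. z \<in> ?C j \<Longrightarrow> bary y (f j) j \<le> bary y z j" if "?C j \<noteq> {}" for j
    using that assms(1) arg_min_if_finite(1)[of "?C j" "\<lambda>x. bary y x j"]
      arg_min_least[of "?C j" _ "\<lambda>x. bary y x j"]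
    unfolding f_def by auto
  let ?S = "f ` (v ` V)"
  have "card ?S \<le> card (v ` V)"
    using assms(1) by (intro card_image_le) auto
  also have "\<dots> \<le> card (UNIV :: 3 set)"
    by (intro card_mono) auto
  finally have "card ?S \<le> 3" by simp
  moreover have "dominating_set (catch_digraph (N_PE y r v) V) ?S"
    unfolding dominating_set_catch_digraph
  proof (intro conjI ballI subsetI)
    fix x assume "x \<in> ?S"
    then obtain z where z: "z \<in> V" "x = f (v z)" by blast
    then show "x \<in> V" using f(1)[of "v z"] by blast
  next
    fix z assume z: "z \<in> V"
    then have ne: "?C (v z) \<noteq> {}" by blast
    let ?x = "f (v z)"
    have x: "?x \<in> V" "v ?x = v z" "bary y ?x (v z) \<le> bary y z (v z)"
      using f[OF ne] z by auto
    have "1 - bary y z (v z) \<le> 1 - bary y ?x (v z)"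
      using x by simp
    also have "\<dots> \<le> r * (1 - bary y ?x (v z))"
      using assms(3) x(1) assms(2) bary_le_one[of ?x "v z"] by (auto simp: mult_le_cancel_right1)
    finally have "z \<in> N_PE y r v ?x"
      using x z assms(2) by (auto simp: N_PE_def)
    then show "\<exists>x\<in>?S. z = x \<or> z \<in> N_PE y r v x" using z by blast
  qed
  ultimately show ?thesis using assms(1) by (intro exI[of _ ?S]) auto
qed

text \<open>A set of at most two points misses some index \<open>j\<close>, so it misses the points that lie, for
  every \<open>k \<noteq> j\<close>, in the strip along the edge opposite \<open>y k\<close> not reached from class \<open>k\<close>.\<close>

lemma domination_number_eq_3I:
  assumes V: "finite V" "V \<subseteq> closed_triangle y - range y" and r: "1 \<le> r"
    and miss: "\<And>x z. x \<in> V \<Longrightarrow> z \<in> N_PE y r v x \<Longrightarrow> \<tau> (v x) \<le> bary y z (v x)"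
    and hit: "\<And>j. \<exists>z\<in>V. \<forall>k. k \<noteq> j \<longrightarrow> bary y z k < \<tau> k"
  shows "domination_number (catch_digraph (N_PE y r v) V) = 3"
proof -
  have False if S: "finite S" "dominating_set (catch_digraph (N_PE y r v) V) S" "card S \<le> 2" for S
  proof -
    have "card (v ` S) \<le> 2"
      using S(1,3) card_image_le le_trans by blast
    then have "v ` S \<noteq> UNIV"
      by (auto dest!: arg_cong[of _ _ card])
    then obtain j where j: "j \<notin> v ` S" by blast
    obtain z where z: "z \<in> V" "\<And>k. k \<noteq> j \<Longrightarrow> bary y z k < \<tau> k"
      using hit by blast
    obtain x where x: "x \<in> S" "z = x \<or> z \<in> N_PE y r v x"
      using S(2) z(1) by (auto simp: dominating_set_catch_digraph)
    have xV: "x \<in> V" using S(2) x by (auto simp: dominating_set_catch_digraph)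
    \<comment> \<open>This absorbs the alternative \<open>z = x\<close>, so that \<open>miss\<close>
      covers both cases.\<close>
    have "x \<in> N_PE y r v x"
      using xV V(2) r bary_le_one by (intro self_in_N_PE) auto
    with x have "z \<in> N_PE y r v x" by blast
    from miss[OF xV this] z(2)[of "v x"] j x(1) show False by fastforce
  qed
  then show ?thesis
    using dominating_set_card_le_3[OF V r, of v] V(1)
    by (subst numeral_3_eq_3, subst domination_number_eq_Suc_iff)
       (auto simp: numeral_3_eq_3 numeral_2_eq_2 catch_digraph_def)
qed

end

section \<open>Completion and independence\<close>

text \<open>The set where \<open>P\<close> and \<open>Q\<close> differ is null, hence measurable in
  the completion. This handles events that depend on the arbitrary values of \<open>v\<close> on
  region boundaries.\<close>

lemma pred_completion_AE_cong:
  assumes P: "Measurable.pred M P" and eq: "AE x in M. P x \<longleftrightarrow> Q x"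
  shows "Measurable.pred (completion M) Q"
proof -
  have "AE x in M. \<not> (P x \<noteq> Q x)"
    using eq by simp
  then have D: "Measurable.pred (completion M) (\<lambda>x. P x \<noteq> Q x)"
    by (rule sets_completion_AE)
  have "Measurable.pred (completion M) P"
    using P by (rule measurable_completion)
  \<comment> \<open>\<open>Q\<close> is recovered as the exclusive disjunction of \<open>P\<close>
    and the difference of \<open>P\<close> and \<open>Q\<close>.\<close>
  then have "Measurable.pred (completion M) (\<lambda>x. \<not> (P x \<longleftrightarrow> (P x \<noteq> Q x)))"
    by (intro pred_intros_logic(2) pred_intros_logic(6)[OF _ D])
  also have "(\<lambda>x. \<not> (P x \<longleftrightarrow> (P x \<noteq> Q x))) = Q"
    by auto
  finally show ?thesis .
qed

lemma (in prob_space) prob_all_notin: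
  assumes "indep_vars (\<lambda>_. N) X UNIV" "\<And>i. distr M N (X i) = D" "A \<in> sets N"
  shows "prob {\<omega> \<in> space M. \<forall>i\<in>{1..n::nat}. X i \<omega> \<notin> A} = (1 - measure D A) ^ n"
\<comment> \<open>The product rule for independent variables needs a nonempty index set.\<close>
proof (cases "n = 0")
  case True
  then show ?thesis by (simp add: prob_space)
next
  case False
  have rv [measurable]: "random_variable N (X i)" for i
    using assms(1) by (auto simp: indep_vars_def)
  have A: "space N - A \<in> sets N"
    using assms(3) by auto
  have p: "prob (X i -` (space N - A) \<inter> space M) = 1 - measure D A" for i
  proof -
    have "X i -` (space N - A) \<inter> space M = space M - (X i -` A \<inter> space M)"
      using measurable_space[OF rv] by auto
    then show ?thesis
      using assms(2)[of i, symmetric] assms(3)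
      by (simp add: prob_compl[OF measurable_sets[OF rv assms(3)]] measure_distr)
  qed
  have "{\<omega> \<in> space M. \<forall>i\<in>{1..n}. X i \<omega> \<notin> A} = (\<Inter>i\<in>{1..n}. X i -` (space N - A) \<inter> space M)"
    using False measurable_space[OF rv] by auto
  also have "prob \<dots> = (\<Prod>i\<in>{1..n}. prob (X i -` (space N - A) \<inter> space M))"
    using False A by (intro indep_varsD[OF assms(1)]) auto
  finally show ?thesis by (simp add: p)
qed

subsection \<open>The uniform distribution on the triangle\<close>

locale triangle_regions = triangle +
  fixes M :: "real^2" and v :: "real^2 \<Rightarrow> 3"
  assumes pos: "\<And>i. bary y M i > 0"
    and region: "region_choice y M v"
begin

text \<open>Points at which \<open>v\<close> is not a matter of choice.\<close>

definition regular :: "real^2 \<Rightarrow> bool" where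
  "regular x \<longleftrightarrow> x \<in> closed_triangle y \<and>
    (\<forall>k l. k \<noteq> l \<longrightarrow> bary y x k * bary y M l \<noteq> bary y x l * bary y M k)"

lemma AE_regular: "AE x in uniform_measure lborel (closed_triangle y). regular x"
proof (rule AE_uniform_measureI)
  have ne: "bary y M l \<noteq> 0" for l using pos[of l] by simp
  have "AE x in lborel. \<forall>k\<in>UNIV. \<forall>l\<in>UNIV - {k}. bary y x k * bary y M l \<noteq> bary y x l * bary y M k"
    by (intro AE_finite_allI AE_bary_ratio) (use ne in auto)
  then show "AE x in lborel. x \<in> closed_triangle y \<longrightarrow> regular x"
    by eventually_elim (auto simp: regular_def)
qed simp

lemma regular_imp: "regular x \<Longrightarrow> x \<in> closed_triangle y - range y"
proof -
  assume x: "regular x"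
  have "x \<noteq> y j" for j
  proof
    assume eq: "x = y j"
    obtain k where k: "k \<noteq> j" using third_index .
    obtain l where l: "l \<noteq> k" "l \<noteq> j" using third_index .
    \<comment> \<open>Both sides vanish, as \<open>k\<close> and \<open>l\<close> differ from
      \<open>j\<close>: a vertex lies on one of the excluded lines.\<close>
    have "bary y (y j) k * bary y M l \<noteq> bary y (y j) l * bary y M k"
      using x l(1) unfolding regular_def eq by metis
    then show False using k l(2) by (simp add: bary_vertex)
  qed
  then show ?thesis using x by (auto simp: regular_def)
qed

lemma bary_region:
  assumes "x \<in> closed_triangle y - range y"
  shows "bary y x k * bary y M (v x) \<le> bary y x (v x) * bary y M k"
  using assms region pos by (intro vertex_region_bary) (auto simp: region_choice_def)

text \<open>Expresses \<open>v\<close> by Borel conditions. If the inequalities hold for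
  \<open>k\<close>, those for \<open>v x\<close> give the reverse one, and regularity rules out
  equality unless \<open>v x = k\<close>.\<close>

lemma regular_region_iff:
  assumes "regular x"
  shows "v x = k \<longleftrightarrow> (\<forall>i. bary y x i * bary y M k \<le> bary y x k * bary y M i)"
proof
  assume R: "\<forall>i. bary y x i * bary y M k \<le> bary y x k * bary y M i"
  have "bary y x k * bary y M (v x) = bary y x (v x) * bary y M k"
    using bary_region[OF regular_imp[OF assms], of k] R[rule_format, of "v x"] by simp
  then show "v x = k"
    using assms unfolding regular_def by metis
qed (use bary_region[OF regular_imp[OF assms]] in auto)

text \<open>Summing \<open>bary_region\<close> over \<open>k\<close> gives the claim, since the
  coordinates of \<open>x\<close> and of \<open>M\<close> sum to 1.\<close>

lemma bary_ge_center:
  assumes "x \<in> closed_triangle y - range y"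
  shows "bary y M (v x) \<le> bary y x (v x)"
proof -
  have "(\<Sum>k\<in>UNIV. bary y x k * bary y M (v x)) \<le> (\<Sum>k\<in>UNIV. bary y x (v x) * bary y M k)"
    by (intro sum_mono bary_region assms)
  then show ?thesis
    by (simp add: sum_bary flip: sum_distrib_left sum_distrib_right)
qed

text \<open>Within region \<open>j\<close>, a bound on coordinate \<open>j\<close> bounds the other
  coordinates from above through \<open>bary_region\<close>. Since they sum to 1, they are also
  bounded below, which leaves a parallelogram around \<open>M\<close> with sides of order
  \<open>\<delta>\<close>.\<close>

lemma near_center:
  obtains B C where "\<And>\<delta>. B \<delta> \<in> sets borel"
    "\<And>\<delta>. \<delta> > 0 \<Longrightarrow> measure (uniform_measure lborel (closed_triangle y)) (B \<delta>) \<le> C * \<delta>\<^sup>2"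
    "\<And>\<delta> x. x \<in> closed_triangle y - range y \<Longrightarrow> v x = j \<Longrightarrow> bary y x j < bary y M j + \<delta> \<Longrightarrow> x \<in> B \<delta>"
proof -
  obtain k where k: "k \<noteq> j" using third_index .
  obtain l where l: "l \<noteq> k" "l \<noteq> j" using third_index .
  have kl: "k \<noteq> l" using l by simp
  have d: "j \<noteq> k" "k \<noteq> l" "j \<noteq> l" using k l by auto
  obtain D where D: "D > 0"
    "\<And>p q p' q'. p \<le> q \<Longrightarrow> p' \<le> q' \<Longrightarrow>
      emeasure lborel {x. bary y x k \<in> {p..q} \<and> bary y x l \<in> {p'..q'}} = ennreal (D * ((q - p) * (q' - p')))"
    using measure_bary_box[OF kl] by blast
  \<comment> \<open>A coordinate exceeds that of \<open>M\<close> by at most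
    \<open>\<delta> / bary y M j\<close>. It falls short by at most \<open>\<delta>\<close> plus
    that amount, since coordinates \<open>j\<close> and the other one can take no more.\<close>
  define K where "K = 1 + 1 / bary y M j"
  have K: "K > 0" using pos[of j] by (simp add: K_def add_pos_pos)
  define I where "I i \<delta> = {bary y M i - K * \<delta> .. bary y M i + K * \<delta>}" for i \<delta>
  define B where "B \<delta> = {x. bary y x k \<in> I k \<delta> \<and> bary y x l \<in> I l \<delta>}" for \<delta>
  define A where "A = measure lborel (closed_triangle y)"
  have A: "A > 0"
    using measure_closed_triangle_pos by (simp add: A_def)
  have sB: "B \<delta> \<in> sets borel" for \<delta>
    unfolding B_def I_def by measurable
  have "measure (uniform_measure lborel (closed_triangle y)) (B \<delta>) \<le> (4 * D * K\<^sup>2 / A) * \<delta>\<^sup>2"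
    if "\<delta> > 0" for \<delta>
  proof -
    have e: "emeasure lborel (B \<delta>) = ennreal (D * ((2 * K * \<delta>) * (2 * K * \<delta>)))"
      using that K unfolding B_def I_def by (subst D(2)) auto
    have "measure lborel (closed_triangle y \<inter> B \<delta>) \<le> measure lborel (B \<delta>)"
      using sB e by (intro measure_mono_fmeasurable) (auto simp: fmeasurable_def)
    also have "\<dots> = D * ((2 * K * \<delta>) * (2 * K * \<delta>))"
      using D(1) K that by (simp add: measure_def e)
    also have "\<dots> = 4 * D * K\<^sup>2 * \<delta>\<^sup>2"
      by (simp add: power2_eq_square)
    finally have "measure lborel (closed_triangle y \<inter> B \<delta>) / A \<le> 4 * D * K\<^sup>2 * \<delta>\<^sup>2 / A"
      using A by (intro divide_right_mono) auto
    then show ?thesis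
      using sB emeasure_closed_triangle by (simp add: A_def)
  qed
  moreover have "x \<in> B \<delta>"
    if x: "x \<in> closed_triangle y - range y" "v x = j" "bary y x j < bary y M j + \<delta>" for x \<delta>
  proof -
    \<comment> \<open>A nonpositive \<open>\<delta>\<close> would contradict
      \<open>bary_ge_center\<close>.\<close>
    have \<delta>: "\<delta> > 0" using bary_ge_center[OF x(1)] x by simp
    have up: "bary y x i \<le> bary y M i + \<delta> / bary y M j" for i
    proof -
      have "bary y x i * bary y M j \<le> bary y x j * bary y M i"
        using bary_region[OF x(1), of i] x(2) by simp
      also have "\<dots> \<le> (bary y M j + \<delta>) * bary y M i"
        using x(3) pos[of i] by (intro mult_right_mono) auto
      also have "\<dots> \<le> bary y M j * bary y M i + \<delta> * 1"
        using \<delta> bary_less_one[OF pos, of i] by (simp add: distrib_right)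
      finally show ?thesis using pos[of j] by (simp add: field_simps)
    qed
    have "bary y x j + bary y x k + bary y x l = 1" "bary y M j + bary y M k + bary y M l = 1"
      using sum_bary by (simp_all add: sum_distinct[OF d, symmetric])
    with up[of k] up[of l] x(3) \<delta> show ?thesis
      by (auto simp: B_def I_def K_def algebra_simps)
  qed
  ultimately show ?thesis using sB that by blast
qed

end

section \<open>Areas of the corners of the triangle\<close>

context triangle
begin

text \<open>For \<open>j \<noteq> h\<close> one of the two bounds is of order
  \<open>\<delta>\<close> and the other is fixed, so the corner at \<open>y j\<close> has area of
  order \<open>\<delta>\<close>. For \<open>j = h\<close> the area is fixed, and
  \<open>\<delta> \<le> 1\<close> again gives a linear lower bound. The minimum over
  \<open>j\<close> makes \<open>\<kappa>\<close> uniform.\<close>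

lemma corner_measure:
  assumes "\<sigma> > 0" "\<sigma> \<le> 1/2"
  obtains \<kappa> where "\<kappa> > 0"
    "\<And>\<delta> j. 0 < \<delta> \<Longrightarrow> \<delta> \<le> 1 \<Longrightarrow> \<kappa> * \<delta> \<le> measure (uniform_measure lborel (closed_triangle y))
      {x \<in> closed_triangle y. \<forall>k. k \<noteq> j \<longrightarrow> bary y x k \<le> (if k = h then \<delta> / 2 else \<sigma>)}"
proof -
  define A where "A = measure lborel (closed_triangle y)"
  have A: "A > 0"
    using measure_closed_triangle_pos by (simp add: A_def)
  let ?U = "uniform_measure lborel (closed_triangle y)"
  let ?s = "\<lambda>\<delta> k. if k = h then \<delta> / 2 else \<sigma>"
  let ?Z = "\<lambda>\<delta> j. {x \<in> closed_triangle y. \<forall>k. k \<noteq> j \<longrightarrow> bary y x k \<le> ?s \<delta> k}"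
  have "\<exists>\<kappa>>0. \<forall>\<delta>. 0 < \<delta> \<longrightarrow> \<delta> \<le> 1 \<longrightarrow> \<kappa> * \<delta> \<le> measure ?U (?Z \<delta> j)" for j
  proof -
    obtain k where k: "k \<noteq> j" using third_index .
    obtain l where l: "l \<noteq> k" "l \<noteq> j" using third_index .
    have kl: "k \<noteq> l" using l by simp
    have d: "j \<noteq> k" "k \<noteq> l" "j \<noteq> l" using k l by auto
    obtain D where D: "D > 0"
      "\<And>p q p' q'. p \<le> q \<Longrightarrow> p' \<le> q' \<Longrightarrow>
        emeasure lborel {x. bary y x k \<in> {p..q} \<and> bary y x l \<in> {p'..q'}} = ennreal (D * ((q - p) * (q' - p')))"
      using measure_bary_box[OF kl] by blast
    have "(D * \<sigma>\<^sup>2 / A) * \<delta> \<le> measure ?U (?Z \<delta> j)" if \<delta>: "0 < \<delta>" "\<delta> \<le> 1" for \<delta>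
    proof -
      let ?B = "{x. bary y x k \<in> {0..?s \<delta> k} \<and> bary y x l \<in> {0..?s \<delta> l}}"
      have all: "(\<forall>i. P i) \<longleftrightarrow> P j \<and> P k \<and> P l" for P
      proof -
        have "i = j \<or> i = k \<or> i = l" for i
          using UNIV_I[of i] unfolding UNIV_distinct[OF d] by simp
        then show ?thesis by metis
      qed
      have s: "?s \<delta> i > 0" "?s \<delta> i \<le> 1/2" for i
        using \<delta> assms by auto
      \<comment> \<open>Both bounds are at most 1/2, so the third coordinate is nonnegative and the
        parallelogram stays in the triangle.\<close>
      have "?B = closed_triangle y \<inter> ?Z \<delta> j"
      proof -
        have "bary y x j \<ge> 0" if "x \<in> ?B" for x
        proof -
          have "bary y x j + bary y x k + bary y x l = 1"
            using sum_bary by (simp add: sum_distinct[OF d, symmetric])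
          then show ?thesis using that s[of k] s[of l] by simp
        qed
        then show ?thesis
          using d by (auto simp: closed_triangle_iff all[of "\<lambda>i. 0 \<le> bary y _ i"]
              all[of "\<lambda>i. i \<noteq> j \<longrightarrow> bary y _ i \<le> _ i"])
      qed
      moreover have "measure lborel ?B = D * (?s \<delta> k * ?s \<delta> l)"
        using D(1) s[of k] s[of l] unfolding measure_def
        by (subst D(2)) (auto simp: less_imp_le)
      moreover have "?Z \<delta> j \<in> sets borel"
        by measurable
      ultimately have "measure ?U (?Z \<delta> j) = D * (?s \<delta> k * ?s \<delta> l) / A"
        using emeasure_closed_triangle by (simp add: A_def)
      moreover have "\<sigma>\<^sup>2 * \<delta> \<le> ?s \<delta> k * ?s \<delta> l"
      proof -
        \<comment> \<open>The first inequality, from \<open>\<sigma> \<le> 1/2\<close>, serves the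
          case where \<open>k\<close> or \<open>l\<close> is \<open>h\<close>; the second, from
          \<open>\<delta> \<le> 1\<close>, serves the case \<open>j = h\<close>.\<close>
        have "\<sigma> * \<delta> * \<sigma> \<le> \<sigma> * \<delta> * (1/2)" "\<sigma> * \<sigma> * \<delta> \<le> \<sigma> * \<sigma> * 1"
          using assms \<delta> by (intro mult_left_mono; simp)+
        then show ?thesis using d by (auto simp: power2_eq_square algebra_simps)
      qed
      ultimately show ?thesis
        using A D(1) by (simp add: divide_right_mono mult.assoc)
    qed
    then show ?thesis
      using A D(1) assms(1) by (intro exI[of _ "D * \<sigma>\<^sup>2 / A"]) simp
  qed
  then have "\<forall>j. \<exists>\<kappa>. \<kappa> > 0 \<and> (\<forall>\<delta>. 0 < \<delta> \<longrightarrow> \<delta> \<le> 1 \<longrightarrow> \<kappa> * \<delta> \<le> measure ?U (?Z \<delta> j))"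
    by (rule allI)
  from choice[OF this] obtain \<kappa> where \<kappa>: "\<And>j. \<kappa> j > 0"
    "\<And>j \<delta>. 0 < \<delta> \<Longrightarrow> \<delta> \<le> 1 \<Longrightarrow> \<kappa> j * \<delta> \<le> measure ?U (?Z \<delta> j)"
    by blast
  show ?thesis
  proof (rule that[of "Min (range \<kappa>)"])
    show "Min (range \<kappa>) > 0" using \<kappa>(1) by simp
    fix \<delta> :: real and j assume \<delta>: "0 < \<delta>" "\<delta> \<le> 1"
    have "Min (range \<kappa>) * \<delta> \<le> \<kappa> j * \<delta>"
      using \<delta> by (intro mult_right_mono) auto
    then show "Min (range \<kappa>) * \<delta> \<le> measure ?U (?Z \<delta> j)"
      using \<kappa>(2)[OF \<delta>] order_trans by blast
  qed
qed

end

section \<open>Measurability of the event and the probability estimate\<close>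

text \<open>Almost surely all sample points are regular. There the event is a finite Boolean
  combination of Borel conditions on coordinates, and the completion absorbs the null set.\<close>

lemma (in triangle_regions) pred_domination_number:
  fixes P :: "'a measure"
  assumes [measurable]: "\<And>i. X i \<in> P \<rightarrow>\<^sub>M borel"
    and "AE \<omega> in P. \<forall>i\<in>{1..n::nat}. regular (X i \<omega>)"
  shows "Measurable.pred (completion P) (\<lambda>\<omega>. domination_number
      (catch_digraph (N_PE y r v) ((\<lambda>i. X i \<omega>) ` {1..n})) = Suc m)"
proof -
  \<comment> \<open>Membership of \<open>z\<close> in the proximity region of \<open>x\<close>, with
    \<open>v x\<close> replaced by the index that \<open>regular_region_iff\<close>
    characterises.\<close>
  let ?A = "\<lambda>x z. \<exists>k\<in>UNIV. (\<forall>i\<in>UNIV. bary y x i * bary y M k \<le> bary y x k * bary y M i) \<and>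
    1 - bary y z k \<le> r * (1 - bary y x k)"
  let ?D = "\<lambda>m \<omega>. \<exists>J\<in>{J\<in>Pow {1..n}. card J \<le> m}. \<forall>i\<in>{1..n}. \<exists>j\<in>J.
    X i \<omega> = X j \<omega> \<or> ?A (X j \<omega>) (X i \<omega>)"
  have [measurable]: "Measurable.pred P (?D m)" for m
  proof (intro pred_intros_finite)
    show "finite J" if "J \<in> {J \<in> Pow {1..n}. card J \<le> m}" for J
      using that finite_subset[of J] by auto
  qed (simp_all, measurable)
  have "Measurable.pred P (\<lambda>\<omega>. ?D (Suc m) \<omega> \<and> \<not> ?D m \<omega>)"
    by (intro pred_intros_logic) measurable
  then show ?thesis
  proof (rule pred_completion_AE_cong)
    show "AE \<omega> in P. (?D (Suc m) \<omega> \<and> \<not> ?D m \<omega>) \<longleftrightarrow> domination_number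
      (catch_digraph (N_PE y r v) ((\<lambda>i. X i \<omega>) ` {1..n})) = Suc m"
      using assms(2)
    proof eventually_elim
      case (elim \<omega>)
      have A: "X i \<omega> \<in> N_PE y r v (X j \<omega>) \<longleftrightarrow> ?A (X j \<omega>) (X i \<omega>)"
        if "i \<in> {1..n}" "j \<in> {1..n}" for i j
      proof -
        have "?A (X j \<omega>) (X i \<omega>) \<longleftrightarrow> (\<exists>k. v (X j \<omega>) = k \<and> 1 - bary y (X i \<omega>) k \<le> r * (1 - bary y (X j \<omega>) k))"
          using elim that(2) by (subst regular_region_iff) auto
        then show ?thesis
          using regular_imp elim that unfolding N_PE_def by auto
      qed
      have D: "?D m \<omega> \<longleftrightarrow> (\<exists>J\<in>{J\<in>Pow {1..n}. card J \<le> m}. \<forall>i\<in>{1..n}. \<exists>j\<in>J.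
          X i \<omega> = X j \<omega> \<or> X i \<omega> \<in> N_PE y r v (X j \<omega>))" for m
        using A by (intro bex_cong ball_cong refl) blast
      show ?case
        by (subst domination_number_eq_Suc_iff)
           (simp_all only: D dominating_set_image_iff finite_atLeastAtMost verts_catch_digraph finite_imageI)
    qed
  qed
qed

text \<open>A union bound: the first error term bounds the probability that a sample point falls
  into the box near \<open>M\<close>, the second that one of the three corners stays empty.
  \<open>C\<close> and \<open>\<kappa>\<close> do not depend on \<open>n\<close> or
  \<open>\<delta>\<close>, so \<open>\<delta>\<close> can be tuned to \<open>n\<close>
  afterwards.\<close>

lemma (in triangle_regions) measure_domination_number_ge:
  fixes P :: "'a measure" and X :: "nat \<Rightarrow> 'a \<Rightarrow> real^2"
  assumes r: "1 < r" and h: "bary y M h = 1 - 1 / r" "\<forall>i. i \<noteq> h \<longrightarrow> bary y M i > 1 - 1 / r"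
    and P: "prob_space P" and indep: "prob_space.indep_vars P (\<lambda>_. borel) X UNIV"
    and X: "\<And>i. distr P borel (X i) = uniform_measure lborel (closed_triangle y)"
  shows "\<exists>C \<kappa>. \<kappa> > 0 \<and> (\<forall>n \<delta>. 0 < \<delta> \<longrightarrow> \<delta> \<le> 1 \<longrightarrow>
      1 - (real n * (C * \<delta>\<^sup>2) + 3 * exp (- \<kappa> * real n * \<delta>)) \<le> measure (completion P)
        {\<omega> \<in> space P. domination_number (catch_digraph (N_PE y r v) ((\<lambda>i. X i \<omega>) ` {1..n})) = 3})"
proof -
  let ?U = "uniform_measure lborel (closed_triangle y)"
  obtain B C where B: "\<And>\<delta>. B \<delta> \<in> sets borel"
    "\<And>\<delta>. \<delta> > 0 \<Longrightarrow> measure ?U (B \<delta>) \<le> C * \<delta>\<^sup>2"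
    "\<And>\<delta> x. x \<in> closed_triangle y - range y \<Longrightarrow> v x = h \<Longrightarrow> bary y x h < bary y M h + \<delta> \<Longrightarrow> x \<in> B \<delta>"
    using near_center[of h] by blast
  \<comment> \<open>If \<open>v x = k\<close> and \<open>bary y x k \<ge> \<beta>\<close>, every
    \<open>z\<close> in the proximity region of \<open>x\<close> has
    \<open>bary y z k \<ge> 1 - r * (1 - \<beta>)\<close>, that is, at least
    \<open>r * (\<beta> - (1 - 1 / r))\<close>. Here \<open>\<beta>\<close> is
    \<open>bary y M k\<close>, raised by \<open>\<delta>\<close> for \<open>k = h\<close>.\<close>
  define \<tau> where "\<tau> \<delta> k = r * (bary y M k - (1 - 1 / r) + (if k = h then \<delta> else 0))" for \<delta> k
  obtain \<sigma> where \<sigma>: "0 < \<sigma>" "\<sigma> \<le> 1/2" "\<And>k. k \<noteq> h \<Longrightarrow> \<sigma> < \<tau> 0 k"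
  proof
    \<comment> \<open>The inserted 1 caps the minimum; halving then gives both
      \<open>\<sigma> \<le> 1/2\<close> and strict inequality below the thresholds.\<close>
    define s where "s = Min (insert 1 (\<tau> 0 ` (UNIV - {h})))"
    have "s > 0" using h r by (auto simp: s_def \<tau>_def)
    moreover have "s \<le> 1" "\<And>k. k \<noteq> h \<Longrightarrow> s \<le> \<tau> 0 k"
      unfolding s_def by (auto intro: Min_le)
    ultimately show "0 < s / 2" "s / 2 \<le> 1 / 2" "\<And>k. k \<noteq> h \<Longrightarrow> s / 2 < \<tau> 0 k"
      by force+
  qed
  obtain \<kappa> where \<kappa>: "\<kappa> > 0"
    "\<And>\<delta> j. 0 < \<delta> \<Longrightarrow> \<delta> \<le> 1 \<Longrightarrow> \<kappa> * \<delta> \<le> measure ?U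
      {x \<in> closed_triangle y. \<forall>k. k \<noteq> j \<longrightarrow> bary y x k \<le> (if k = h then \<delta> / 2 else \<sigma>)}"
    using corner_measure[OF \<sigma>(1,2), of h] by blast
  show ?thesis
  proof (rule exI[of _ C], rule exI[of _ \<kappa>], intro conjI allI impI)
    show "\<kappa> > 0" by (rule \<kappa>(1))
  next
    fix n :: nat and \<delta> :: real
    assume \<delta>: "0 < \<delta>" "\<delta> \<le> 1"
    interpret prob_space P by fact
    have rv [measurable]: "X i \<in> P \<rightarrow>\<^sub>M borel" for i
      using indep by (auto simp: indep_vars_def)
    define Z where "Z j = {x \<in> closed_triangle y. \<forall>k\<in>UNIV. k \<noteq> j \<longrightarrow> bary y x k \<le> (if k = h then \<delta> / 2 else \<sigma>)}" for j
    have Z [measurable]: "Z j \<in> sets borel" for j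
      unfolding Z_def by measurable
    note [measurable] = B(1)
    have AE: "AE \<omega> in P. \<forall>i\<in>{1..n}. regular (X i \<omega>)"
    proof (rule AE_finite_allI)
      show "AE \<omega> in P. regular (X i \<omega>)" for i
        using AE_regular unfolding X[of i, symmetric] by (rule AE_distrD[OF rv])
    qed simp
    let ?E = "{\<omega> \<in> space P. domination_number (catch_digraph (N_PE y r v) ((\<lambda>i. X i \<omega>) ` {1..n})) = 3}"
    let ?F1 = "\<lambda>i. {\<omega> \<in> space P. X i \<omega> \<in> B \<delta>}"
    let ?F2 = "\<lambda>j. {\<omega> \<in> space P. \<forall>i\<in>{1..n}. X i \<omega> \<notin> Z j}"
    let ?F = "(\<Union>i\<in>{1..n}. ?F1 i) \<union> (\<Union>j\<in>UNIV. ?F2 j)"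
    have F: "?F1 i \<in> events" "?F2 j \<in> events" for i j
      by measurable
    \<comment> \<open>The argument \<open>2\<close> stands for \<open>m\<close>, since the predicate
      is stated for \<open>Suc m\<close>.\<close>
    have E: "?E \<in> sets (completion P)"
      using pred_domination_number[OF rv AE, of r 2] by (simp add: pred_def)
    have good: "\<omega> \<in> ?E" if \<omega>: "\<omega> \<in> space P - ?F" "\<forall>i\<in>{1..n}. regular (X i \<omega>)" for \<omega>
    proof -
      let ?V = "(\<lambda>i. X i \<omega>) ` {1..n}"
      have V: "?V \<subseteq> closed_triangle y - range y"
        using \<omega>(2) by (intro image_subsetI regular_imp) simp
      have "domination_number (catch_digraph (N_PE y r v) ?V) = 3"
      proof (rule domination_number_eq_3I[where \<tau> = "\<tau> \<delta>"])
        show "\<tau> \<delta> (v x) \<le> bary y z (v x)" if x: "x \<in> ?V" and z: "z \<in> N_PE y r v x" for x z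
        proof -
          have xT: "x \<in> closed_triangle y - range y" using x V by blast
          have "x \<notin> B \<delta>" using x \<omega>(1) by blast
          then have "bary y x h \<ge> bary y M h + \<delta>" if "v x = h"
            using B(3)[OF xT that, of \<delta>] by argo
          then have "bary y M (v x) + (if v x = h then \<delta> else 0) \<le> bary y x (v x)"
            using bary_ge_center[OF xT] by auto
          then have "r * (bary y M (v x) + (if v x = h then \<delta> else 0)) \<le> r * bary y x (v x)"
            using r by (intro mult_left_mono) auto
          moreover have "\<tau> \<delta> (v x) = r * (bary y M (v x) + (if v x = h then \<delta> else 0)) - (r - 1)"
            using r by (simp add: \<tau>_def algebra_simps)
          moreover have "1 - bary y z (v x) \<le> r - r * bary y x (v x)"
            using z xT by (auto simp: N_PE_def algebra_simps split: if_splits)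
          ultimately show ?thesis by linarith
        qed
        show "\<exists>z\<in>?V. \<forall>k. k \<noteq> j \<longrightarrow> bary y z k < \<tau> \<delta> k" for j
        proof -
          obtain i where i: "i \<in> {1..n}" "X i \<omega> \<in> Z j"
            using \<omega>(1) by blast
          have "bary y (X i \<omega>) k < \<tau> \<delta> k" if k: "k \<noteq> j" for k
          proof (cases "k = h")
            case True
            \<comment> \<open>For \<open>k = h\<close> the threshold is exactly
              \<open>r * \<delta>\<close>, because \<open>bary y M h = 1 - 1 / r\<close>.\<close>
            have "\<delta> / 2 < 1 * \<delta>" using \<delta> by simp
            also have "\<dots> \<le> r * \<delta>" using r \<delta> by (intro mult_right_mono) auto
            finally show ?thesis using i(2) k True by (auto simp: Z_def \<tau>_def h(1))
          next
            case False
            then have "bary y (X i \<omega>) k \<le> \<sigma>" using i(2) k by (auto simp: Z_def)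
            with \<sigma>(3)[OF False] False show ?thesis by (simp add: \<tau>_def)
          qed
          then show ?thesis using i(1) by blast
        qed
      qed (use V r in auto)
      then show ?thesis using \<omega>(1) by simp
    qed
    have 1: "prob (?F1 i) \<le> C * \<delta>\<^sup>2" for i
    proof -
      have "prob (?F1 i) = measure (distr P borel (X i)) (B \<delta>)"
        by (simp add: measure_distr vimage_def Int_def conj_commute)
      then show ?thesis using B(2)[OF \<delta>(1)] by (simp add: X)
    qed
    have 2: "prob (?F2 j) \<le> exp (- \<kappa> * real n * \<delta>)" for j
    proof -
      have U: "prob_space ?U"
        using prob_space_distr[OF rv] X by metis
      have "prob (?F2 j) = (1 - measure ?U (Z j)) ^ n"
        by (rule prob_all_notin[OF indep X Z])
      also have "\<dots> \<le> exp (- \<kappa> * \<delta>) ^ n"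
      proof (rule power_mono)
        have "1 - measure ?U (Z j) \<le> 1 + (- \<kappa> * \<delta>)"
          using \<kappa>(2)[OF \<delta>, of j] by (simp add: Z_def)
        also have "\<dots> \<le> exp (- \<kappa> * \<delta>)" by (rule exp_ge_add_one_self)
        finally show "1 - measure ?U (Z j) \<le> exp (- \<kappa> * \<delta>)" .
      qed (simp add: prob_space.prob_le_1[OF U])
      also have "\<dots> = exp (- \<kappa> * real n * \<delta>)"
        by (simp add: exp_of_nat_mult[symmetric] mult_ac)
      finally show ?thesis .
    qed
    have "prob ?F \<le> prob (\<Union>i\<in>{1..n}. ?F1 i) + prob (\<Union>j\<in>UNIV. ?F2 j)"
      using F by (intro measure_Un_le sets.finite_UN) auto
    also have "\<dots> \<le> (\<Sum>i\<in>{1..n}. prob (?F1 i)) + (\<Sum>j\<in>UNIV. prob (?F2 j))"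
      using F by (intro add_mono measure_UNION_le) auto
    also have "\<dots> \<le> (\<Sum>i\<in>{1..n}. C * \<delta>\<^sup>2) + (\<Sum>j\<in>(UNIV::3 set). exp (- \<kappa> * real n * \<delta>))"
      by (intro add_mono sum_mono 1 2)
    finally have "prob ?F \<le> real n * (C * \<delta>\<^sup>2) + 3 * exp (- \<kappa> * real n * \<delta>)"
      by simp
    moreover have sF: "?F \<in> events"
      using F by (intro sets.Un sets.finite_UN) auto
    ultimately have "1 - (real n * (C * \<delta>\<^sup>2) + 3 * exp (- \<kappa> * real n * \<delta>)) \<le> prob (space P - ?F)"
      by (simp add: prob_compl)
    also have "\<dots> = measure (completion P) (space P - ?F)"
      using sF by (simp add: sets.compl_sets)
    \<comment> \<open>The inclusion holds only almost everywhere, as \<open>good\<close> also asks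
      for regular sample points.\<close>
    also have "\<dots> \<le> measure (completion P) ?E"
    proof (rule finite_measure.finite_measure_mono_AE)
      show "finite_measure (completion P)"
        using prob_space_completion by (rule prob_space.finite_measure)
      show "AE \<omega> in completion P. \<omega> \<in> space P - ?F \<longrightarrow> \<omega> \<in> ?E"
        unfolding AE_completion_iff using AE
      proof eventually_elim
        case (elim \<omega>)
        then show ?case using good by (intro impI)
      qed
    qed (rule E)
    finally show "1 - (real n * (C * \<delta>\<^sup>2) + 3 * exp (- \<kappa> * real n * \<delta>)) \<le> measure (completion P) ?E" .
  qed
qed

theorem theorem8:
  fixes y :: "3 \<Rightarrow> real^2" and r :: real and M :: "real^2" and v :: "real^2 \<Rightarrow> 3"
    and P :: "'a measure" and X :: "nat \<Rightarrow> 'a \<Rightarrow> real^2"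
  assumes "\<not> collinear (range y)"
    and "1 < r" and "r < 3 / 2"
    and "M \<in> frontier (inner_triangle y r) - range (inner_vertex y r)"
    and "region_choice y M v"
    and "prob_space P"
    and "prob_space.indep_vars P (\<lambda>_. borel) X UNIV"
    and "\<And>i. distr P borel (X i) = uniform_measure lborel (closed_triangle y)"
  shows "(\<lambda>n. measure (completion P)
            {\<omega> \<in> space P. domination_number
               (catch_digraph (N_PE y r v) ((\<lambda>i. X i \<omega>) ` {1..n})) = 3})
          \<longlonglongrightarrow> 1"
    (is "?p \<longlonglongrightarrow> 1")
proof -
  interpret triangle y by unfold_locales fact
  obtain h where h: "bary y M h = 1 - 1 / r" "\<forall>i. i \<noteq> h \<longrightarrow> bary y M i > 1 - 1 / r"
    using frontier_inner_triangle_nonvertex[OF assms(2,4)] by blast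
  have pos: "bary y M i > 0" for i
  proof -
    have "1 - 1 / r > 0" using assms(2) by simp
    then show ?thesis using h by (metis order.strict_trans)
  qed
  interpret triangle_regions y M v
    by unfold_locales (rule pos assms(5))+
  obtain C \<kappa> where \<kappa>: "\<kappa> > 0" and le: "\<forall>n \<delta>. 0 < \<delta> \<longrightarrow> \<delta> \<le> 1 \<longrightarrow>
      1 - (real n * (C * \<delta>\<^sup>2) + 3 * exp (- \<kappa> * real n * \<delta>)) \<le> ?p n"
    using measure_domination_number_ge[OF assms(2) h assms(6-8)] by (elim exE conjE)
  show ?thesis
  proof (rule tendsto_sandwich)
    \<comment> \<open>With \<open>\<delta> = n powr (- 2 / 3)\<close> both \<open>n * \<delta>\<^sup>2 \<rightarrow> 0\<close> and \<open>n * \<delta> \<rightarrow> \<infinity>\<close>.\<close>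
    let ?\<delta> = "\<lambda>n. real n powr (- 2 / 3)"
    show "(\<lambda>n. 1 - (real n * (C * (?\<delta> n)\<^sup>2) + 3 * exp (- \<kappa> * real n * ?\<delta> n))) \<longlonglongrightarrow> 1"
      using \<kappa> by real_asymp
    show "\<forall>\<^sub>F n in sequentially. 1 - (real n * (C * (?\<delta> n)\<^sup>2) + 3 * exp (- \<kappa> * real n * ?\<delta> n)) \<le> ?p n"
      \<comment> \<open>At \<open>n = 0\<close> the power evaluates to 0, which violates
        \<open>0 < \<delta>\<close>.\<close>
      using eventually_gt_at_top[of 0]
    proof eventually_elim
      case (elim n)
      have "?\<delta> n \<le> real n powr 0"
        using elim by (intro powr_mono) auto
      then show ?case using elim by (intro le[rule_format]) auto
    qed
    show "\<forall>\<^sub>F n in sequentially. ?p n \<le> 1"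
      using prob_space.prob_le_1[OF prob_space.prob_space_completion[OF assms(6)]] by simp
  qed simp
qed

end
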